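(* Let $k\colon R\to\mathbb{C}$ be a $W$-invariant multiplicity function with $\operatorname{Re} k_\alpha\ge 0$ for all $\alpha\in R$, and let $\lambda\in\mathfrak{a}_{\mathrm{reg}}$. Then there exists a constant $C=C_{R,k,\lambda}\ge 0$ such that $$|\operatorname{Exp}_k(i\lambda,x)|\le C\,\big|\Omega_k^{-1/2}(x)\big|\qquad\text{for all } x\in\mathfrak{a}.$$
   Context: $(\mathfrak{a},\langle\cdot,\cdot\rangle)$ is a finite-dimensional Euclidean space; $\langle\cdot,\cdot\rangle$ is extended to a complex bilinear form on $\mathfrak{a}_{\mathbb{C}}=\mathbb{C}\otimes_{\mathbb{R}}\mathfrak{a}$. $R\subseteq\mathfrak{a}$ is a reduced root system spanning $\mathfrak{a}$ (a finite set of nonzero vectors, stable under all its reflections, with $R\cap\mathbb{R}\alpha=\{\pm\alpha\}$; the crystallographic condition is not imposed), normalized by $\langle\alpha,\alpha\rangle=2$ for all $\alpha\in R$. $W$ is the finite reflection group generated by $s_\alpha(x)=x-\langle\alpha,x\rangle\alpha$, $\alpha\in R$. $R_+\subseteq R$ is a fixed set of positive roots. $\mathfrak{a}_{\mathrm{reg}}=\{x\in\mathfrak{a}:\langle\alpha,x\rangle\ne0\ \forall\alpha\in R\}$. For a $W$-invariant $k\colon R\to\mathbb{C}$, the Dunkl operator in direction $\xi\in\mathfrak{a}$ is $T_\xi=\partial_\xi+\sum_{\alpha\in R_+}k_\alpha\langle\alpha,\xi\rangle\frac{1-s_\alpha}{\langle\alpha,\cdot\rangle}$, where $(s_\alpha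 f)(x)=f(s_\alpha x)$. If $\operatorname{Re}k\ge0$ (i.e. $\operatorname{Re}k_\alpha\geq 0$ for all $\alpha$), the Dunkl kernel $\operatorname{Exp}_k\colon\mathfrak{a}_{\mathbb{C}}\times\mathfrak{a}_{\mathbb{C}}\to\mathbb{C}$ is the unique holomorphic function such that for every $\lambda\in\mathfrak{a}_{\mathbb{C}}$, $f=\operatorname{Exp}_k(\lambda,\cdot)$ is the unique solution of $T_\xi f=\langle\xi,\lambda\rangle f$ for all $\xi\in\mathfrak{a}$, $f(0)=1$. $\Omega_k(x)=\prod_{\alpha\in R_+}(1+|\langle\alpha,x\rangle|)^{2k_\alpha}$ and $\Omega_k^{-1/2}(x)=\prod_{\alpha\in R_+}(1+|\langle\alpha,x\rangle|)^{-k_\alpha}$ for $x\in\mathfrak{a}$. *)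

theory Defs
  imports "HOL-Analysis.Analysis"
begin

section \<open>Complexification of a Euclidean space\<close>

text \<open>The pair \<open>(x, y)\<close> stands for the element \<open>x + \<i>y\<close> of the complexification, which
  thereby carries the library's topology and real differentiable structure of a product.\<close>

type_synonym 'a cplxn = "'a \<times> 'a"

definition cemb :: "'a::real_vector \<Rightarrow> 'a cplxn" where
  "cemb x = (x, 0)"

definition cscale :: "complex \<Rightarrow> 'a::real_vector cplxn \<Rightarrow> 'a cplxn" where
  "cscale c z = (Re c *\<^sub>R fst z - Im c *\<^sub>R snd z, Im c *\<^sub>R fst z + Re c *\<^sub>R snd z)"

text \<open>The complex bilinear (not sesquilinear) extension of the inner product.\<close>

definition cbil :: "'a::real_inner cplxn \<Rightarrow> 'a cplxn \<Rightarrow> complex" where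
  "cbil z w = Complex (fst z \<bullet> fst w - snd z \<bullet> snd w) (fst z \<bullet> snd w + snd z \<bullet> fst w)"

text \<open>Joint holomorphy on the product of two complexifications: everywhere Frechet
  differentiable with complex linear derivative.\<close>

definition holomorphic_cplxn2 ::
  "('a::real_normed_vector cplxn \<Rightarrow> 'a cplxn \<Rightarrow> complex) \<Rightarrow> bool" where
  "holomorphic_cplxn2 E \<longleftrightarrow>
     (\<forall>l z. \<exists>D. ((\<lambda>p. E (fst p) (snd p)) has_derivative D) (at (l, z)) \<and>
        (\<forall>c u v. D (cscale c u, cscale c v) = c * D (u, v)))"

section \<open>Root systems\<close>

text \<open>This is the reflection in the hyperplane orthogonal to \<open>\<alpha>\<close> only for \<open>\<alpha> \<bullet> \<alpha> = 2\<close>, a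
  normalization that is part of \<open>reduced_root_system\<close> below.\<close>

definition refl_root :: "'a::real_inner \<Rightarrow> 'a \<Rightarrow> 'a" where
  "refl_root \<alpha> x = x - (\<alpha> \<bullet> x) *\<^sub>R \<alpha>"

definition crefl_root :: "'a::real_inner \<Rightarrow> 'a cplxn \<Rightarrow> 'a cplxn" where
  "crefl_root \<alpha> z = z - cscale (cbil (cemb \<alpha>) z) (cemb \<alpha>)"

definition reduced_root_system :: "'a::euclidean_space set \<Rightarrow> bool" where
  "reduced_root_system R \<longleftrightarrow>
     finite R \<and> 0 \<notin> R \<and> span R = UNIV \<and>
     (\<forall>\<alpha>\<in>R. \<alpha> \<bullet> \<alpha> = 2) \<and>
     (\<forall>\<alpha>\<in>R. refl_root \<alpha> ` R = R) \<and>
     (\<forall>\<alpha>\<in>R. R \<inter> range (\<lambda>c::real. c *\<^sub>R \<alpha>) = {\<alpha>, - \<alpha>})"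

definition positive_roots :: "'a::real_inner set \<Rightarrow> 'a set \<Rightarrow> bool" where
  "positive_roots R Rp \<longleftrightarrow>
     (\<exists>v. (\<forall>\<alpha>\<in>R. \<alpha> \<bullet> v \<noteq> 0) \<and> Rp = {\<alpha> \<in> R. \<alpha> \<bullet> v > 0})"

text \<open>Since the generators are involutions, the monoid they generate is the group.\<close>

inductive_set refl_group :: "'a::real_inner set \<Rightarrow> ('a \<Rightarrow> 'a) set" for R where
  refl_group_id: "id \<in> refl_group R"
| refl_group_step: "\<alpha> \<in> R \<Longrightarrow> w \<in> refl_group R \<Longrightarrow> refl_root \<alpha> \<circ> w \<in> refl_group R"

text \<open>Multiplicity functions are total functions of which only the values on \<open>R\<close> matter.\<close>

definition invariant_multiplicity :: "'a::real_inner set \<Rightarrow> ('a \<Rightarrow> complex) \<Rightarrow> bool" where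
  "invariant_multiplicity R k \<longleftrightarrow> (\<forall>w\<in>refl_group R. \<forall>\<alpha>\<in>R. k (w \<alpha>) = k \<alpha>)"

definition regular_points :: "'a::real_inner set \<Rightarrow> 'a set" where
  "regular_points R = {x. \<forall>\<alpha>\<in>R. \<alpha> \<bullet> x \<noteq> 0}"

section \<open>Dunkl operators and the Dunkl kernel\<close>

definition dir_deriv ::
  "'a::real_normed_vector \<Rightarrow> ('a cplxn \<Rightarrow> complex) \<Rightarrow> 'a cplxn \<Rightarrow> complex" where
  "dir_deriv \<xi> f z = frechet_derivative f (at z) (cemb \<xi>)"

text \<open>The quotient \<open>(1 - s\<^sub>\<alpha>) f / \<langle>\<alpha>, \<cdot>\<rangle>\<close> has a removable singularity along the hyperplane
  \<open>\<langle>\<alpha>, z\<rangle> = 0\<close>. Its value there is the derivative of \<open>f\<close> in direction \<open>\<alpha>\<close>: for such \<open>z\<close> the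
  quotient at \<open>z + t\<alpha>\<close> is \<open>(f (z + t\<alpha>) - f (z - t\<alpha>)) / 2t\<close>, as \<open>\<alpha> \<bullet> \<alpha> = 2\<close>.\<close>

definition dunkl_quotient ::
  "'a::real_inner \<Rightarrow> ('a cplxn \<Rightarrow> complex) \<Rightarrow> 'a cplxn \<Rightarrow> complex" where
  "dunkl_quotient \<alpha> f z =
     (if cbil (cemb \<alpha>) z = 0 then dir_deriv \<alpha> f z
      else (f z - f (crefl_root \<alpha> z)) / cbil (cemb \<alpha>) z)"

definition dunkl_op ::
  "'a::real_inner set \<Rightarrow> ('a \<Rightarrow> complex) \<Rightarrow> 'a \<Rightarrow> ('a cplxn \<Rightarrow> complex) \<Rightarrow> 'a cplxn \<Rightarrow> complex" where
  "dunkl_op Rp k \<xi> f z =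
     dir_deriv \<xi> f z + (\<Sum>\<alpha>\<in>Rp. k \<alpha> * of_real (\<alpha> \<bullet> \<xi>) * dunkl_quotient \<alpha> f z)"

text \<open>\<open>dunkl_kernel Rp k E\<close> says that \<open>E\<close> is the Dunkl kernel \<open>Exp\<^sub>k\<close>. For multiplicities with
  nonnegative real part, exactly one function has this property (Opdam).\<close>

definition dunkl_kernel ::
  "'a::euclidean_space set \<Rightarrow> ('a \<Rightarrow> complex) \<Rightarrow> ('a cplxn \<Rightarrow> 'a cplxn \<Rightarrow> complex) \<Rightarrow> bool" where
  "dunkl_kernel Rp k E \<longleftrightarrow>
     holomorphic_cplxn2 E \<and>
     (\<forall>l. E l 0 = 1 \<and>
        (\<forall>\<xi> z. dunkl_op Rp k \<xi> (E l) z = cbil (cemb \<xi>) l * E l z))"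

definition Omega_inv_sqrt :: "'a::real_inner set \<Rightarrow> ('a \<Rightarrow> complex) \<Rightarrow> 'a \<Rightarrow> complex" where
  "Omega_inv_sqrt Rp k x = (\<Prod>\<alpha>\<in>Rp. complex_of_real (1 + \<bar>\<alpha> \<bullet> x\<bar>) powr (- k \<alpha>))"

end

theory Submission
  imports Defs
begin

text \<open>Restrict \<open>f = Exp\<^sub>k(i\<lambda>, \<cdot>)\<close> to a ray \<open>t \<mapsto> t x\<close>. For \<open>y\<close> in the orbit \<open>W x\<close> the functions
  \<open>f(t y)\<close> satisfy a linear system in which \<open>f(t y)\<close> has frequency \<open>\<langle>y, \<lambda>\<rangle>\<close> and the coupling is
  \<open>- (k\<^sub>\<alpha> / t) (f(t y) - f(t s\<^sub>\<alpha> y))\<close>. Multiply by the \<open>W\<close>-invariant weight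
  \<open>\<Prod> (m\<^sup>2 + \<langle>\<alpha>, t x\<rangle>\<^sup>2)\<close> to the power \<open>Re k\<^sub>\<alpha> / 2\<close>. The derivative of the energy \<open>\<Sum> \<bar>\<Phi>\<^sub>y\<bar>\<^sup>2\<close> of the
  weighted functions is a dissipative part plus the terms
  \<open>2 Re k\<^sub>\<alpha> a g(a t) Re (cnj \<Phi>\<^sub>y \<cdot> \<Phi>\<^bsub>s\<^sub>\<alpha> y\<^esub>)\<close> with \<open>a = \<langle>\<alpha>, y\<rangle>\<close>, \<open>g(r) = r / (m\<^sup>2 + r\<^sup>2)\<close>. These are
  not absolutely integrable uniformly in \<open>x\<close>, but they oscillate with frequency \<open>a \<langle>\<alpha>, \<lambda>\<rangle>\<close>, where
  \<open>\<langle>\<alpha>, \<lambda>\<rangle> \<noteq> 0\<close> by regularity. Subtracting their approximate antiderivative leaves an error of at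
  most a constant times \<open>\<bar>a\<bar> / (m\<^sup>2 + a\<^sup>2 t\<^sup>2)\<close> times the energy, whose coefficient has integral at most
  \<open>\<pi> / 2m\<close> for every \<open>a\<close>: hence the bound is uniform up to the walls. For large \<open>m\<close> the corrected
  energy is comparable to the energy, and Gronwall's inequality concludes.\<close>

section \<open>Weakly damped oscillators\<close>

text \<open>\<open>\<Phi> y\<close> is the weighted function on the ray through \<open>y\<close>, \<open>H\<close> the logarithmic derivative of the
  weight, \<open>a \<alpha> y = \<langle>\<alpha>, y\<rangle>\<close>, \<open>c \<alpha> = \<langle>\<alpha>, \<lambda>\<rangle>\<close> and \<open>\<mu> y = \<langle>y, \<lambda>\<rangle>\<close>.\<close>

locale damped_oscillators =
  fixes Y :: "'b set" and A :: "'c set" and s :: "'c \<Rightarrow> 'b \<Rightarrow> 'b"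
    and a :: "'c \<Rightarrow> 'b \<Rightarrow> real" and c :: "'c \<Rightarrow> real" and \<mu> :: "'b \<Rightarrow> real"
    and k :: "'c \<Rightarrow> complex" and m :: real
    and H :: "real \<Rightarrow> real" and \<Phi> :: "'b \<Rightarrow> real \<Rightarrow> complex"
  assumes finite_Y: "finite Y" and finite_A: "finite A"
    and s_closed: "\<And>\<alpha> y. \<alpha> \<in> A \<Longrightarrow> y \<in> Y \<Longrightarrow> s \<alpha> y \<in> Y"
    and s_invol: "\<And>\<alpha> y. \<alpha> \<in> A \<Longrightarrow> y \<in> Y \<Longrightarrow> s \<alpha> (s \<alpha> y) = y"
    and a_s: "\<And>\<alpha> y. \<alpha> \<in> A \<Longrightarrow> y \<in> Y \<Longrightarrow> a \<alpha> (s \<alpha> y) = - a \<alpha> y"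
    and c_nz: "\<And>\<alpha>. \<alpha> \<in> A \<Longrightarrow> c \<alpha> \<noteq> 0"
    and \<mu>_s: "\<And>\<alpha> y. \<alpha> \<in> A \<Longrightarrow> y \<in> Y \<Longrightarrow> \<mu> y - \<mu> (s \<alpha> y) = a \<alpha> y * c \<alpha>"
    and k_nonneg: "\<And>\<alpha>. \<alpha> \<in> A \<Longrightarrow> 0 \<le> Re (k \<alpha>)"
    and m_ge_1: "1 \<le> m"
    and m_large: "2 * real (card Y) * (\<Sum>\<alpha>\<in>A. Re (k \<alpha>) / \<bar>c \<alpha>\<bar>) \<le> m"
    and H_eq: "\<And>y t. y \<in> Y \<Longrightarrow> 0 < t \<Longrightarrow>
      H t = (\<Sum>\<alpha>\<in>A. Re (k \<alpha>) * ((a \<alpha> y)\<^sup>2 * t / (m\<^sup>2 + (a \<alpha> y)\<^sup>2 * t\<^sup>2)))"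
    and \<Phi>_cont: "\<And>y. y \<in> Y \<Longrightarrow> continuous_on {0..} (\<Phi> y)"
    and \<Phi>_deriv: "\<And>y t. y \<in> Y \<Longrightarrow> 0 < t \<Longrightarrow>
      (\<Phi> y has_vector_derivative
        ((of_real (H t) + \<i> * of_real (\<mu> y)) * \<Phi> y t
          - (\<Sum>\<alpha>\<in>A. k \<alpha> / of_real t * (\<Phi> y t - \<Phi> (s \<alpha> y) t)))) (at t)"
begin

section \<open>Energy, oscillating products and their correction\<close>

definition energy :: "real \<Rightarrow> real" where
  "energy t = (\<Sum>y\<in>Y. (cmod (\<Phi> y t))\<^sup>2)"

text \<open>The derivative of \<open>\<Phi> y\<close> without its rotation term: the part of size
  O(1 / t).\<close>

definition damping :: "'b \<Rightarrow> real \<Rightarrow> complex" where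
  "damping y t = of_real (H t) * \<Phi> y t - (\<Sum>\<alpha>\<in>A. k \<alpha> / of_real t * (\<Phi> y t - \<Phi> (s \<alpha> y) t))"

definition velocity :: "'b \<Rightarrow> real \<Rightarrow> complex" where
  "velocity y t = \<i> * of_real (\<mu> y) * \<Phi> y t + damping y t"

definition cross :: "'c \<Rightarrow> 'b \<Rightarrow> real \<Rightarrow> complex" where
  "cross \<alpha> y t = cnj (\<Phi> y t) * \<Phi> (s \<alpha> y) t"

definition g :: "'c \<Rightarrow> 'b \<Rightarrow> real \<Rightarrow> real" where
  "g \<alpha> y t = a \<alpha> y * t / (m\<^sup>2 + (a \<alpha> y)\<^sup>2 * t\<^sup>2)"

text \<open>A common majorant for the derivative of \<open>g\<close> and for
  \<open>\<bar>g\<bar> / t\<close>, the two quantities in the errors left by the correction.\<close>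

definition \<rho> :: "'c \<Rightarrow> 'b \<Rightarrow> real \<Rightarrow> real" where
  "\<rho> \<alpha> y t = \<bar>a \<alpha> y\<bar> / (m\<^sup>2 + (a \<alpha> y)\<^sup>2 * t\<^sup>2)"

definition ksum :: real where
  "ksum = (\<Sum>\<alpha>\<in>A. cmod (k \<alpha>))"

text \<open>The 1 accounts for the derivative of \<open>g\<close>, the \<open>6 * ksum\<close> for
  the damping of the two factors of \<open>cross\<close>.\<close>

definition rate :: "'c \<Rightarrow> real" where
  "rate \<alpha> = 2 * Re (k \<alpha>) / \<bar>c \<alpha>\<bar> * (1 + 6 * ksum)"

text \<open>To leading order \<open>Im (cross \<alpha> y t) / c \<alpha>\<close> has derivative
  \<open>- a \<alpha> y * Re (cross \<alpha> y t)\<close>. Dividing by \<open>c \<alpha>\<close>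
  alone, never by \<open>a \<alpha> y\<close>, keeps the term harmless near the walls.\<close>

definition correction :: "real \<Rightarrow> real" where
  "correction t = (\<Sum>\<alpha>\<in>A. \<Sum>y\<in>Y. 2 * Re (k \<alpha>) / c \<alpha> * (g \<alpha> y t * Im (cross \<alpha> y t)))"

section \<open>Pointwise bounds\<close>

lemma denom_pos: "0 < m\<^sup>2 + (a \<alpha> y)\<^sup>2 * t\<^sup>2"
  using m_ge_1 by (simp add: add_pos_nonneg)

lemma \<Phi>_velocity: "y \<in> Y \<Longrightarrow> 0 < t \<Longrightarrow> (\<Phi> y has_vector_derivative velocity y t) (at t)"
  using \<Phi>_deriv[of y t] by (simp add: velocity_def damping_def algebra_simps)

lemma energy_nonneg: "0 \<le> energy t"
  by (simp add: energy_def sum_nonneg)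

lemma cmod_\<Phi>_le: "y \<in> Y \<Longrightarrow> cmod (\<Phi> y t) \<le> sqrt (energy t)"
  unfolding energy_def
  by (intro real_le_rsqrt member_le_sum) (auto simp: finite_Y)

lemma cmod_product_le: "y \<in> Y \<Longrightarrow> z \<in> Y \<Longrightarrow> cmod (\<Phi> y t) * cmod (\<Phi> z t) \<le> energy t"
  using mult_mono[OF cmod_\<Phi>_le cmod_\<Phi>_le, of y z t t] energy_nonneg[of t] by simp

lemma cmod_cross_le: "\<alpha> \<in> A \<Longrightarrow> y \<in> Y \<Longrightarrow> cmod (cross \<alpha> y t) \<le> energy t"
  unfolding cross_def norm_mult using cmod_product_le[of y "s \<alpha> y" t] s_closed by simp

lemma sum_swap:
  fixes F :: "'b \<Rightarrow> real"
  assumes "\<alpha> \<in> A"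
  shows "(\<Sum>y\<in>Y. F (s \<alpha> y)) = (\<Sum>y\<in>Y. F y)"
  by (rule sum.reindex_bij_witness[where i="s \<alpha>" and j="s \<alpha>"]) (auto simp: s_closed s_invol assms)

lemma g_over_t: "0 < t \<Longrightarrow> \<bar>g \<alpha> y t\<bar> / t = \<rho> \<alpha> y t"
  using denom_pos[of \<alpha> y t] by (simp add: g_def \<rho>_def abs_mult)

text \<open>Arithmetic-geometric mean inequality for \<open>m\<close> and
  \<open>\<bar>a \<alpha> y\<bar> * \<bar>t\<bar>\<close>. The decay in \<open>m\<close> is what
  makes the correction small.\<close>

lemma abs_g_le: "\<bar>g \<alpha> y t\<bar> \<le> 1 / (2 * m)"
proof -
  have "2 * m * (\<bar>a \<alpha> y\<bar> * \<bar>t\<bar>) \<le> m\<^sup>2 + (\<bar>a \<alpha> y\<bar> * \<bar>t\<bar>)\<^sup>2"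
    using sum_squares_bound[of m "\<bar>a \<alpha> y\<bar> * \<bar>t\<bar>"] by simp
  then show ?thesis
    using denom_pos[of \<alpha> y t] m_ge_1
    by (simp add: g_def abs_mult power_mult_distrib field_simps)
qed

lemma H_bounds:
  assumes "y \<in> Y" "0 < t"
  shows "0 \<le> H t" and "H t \<le> ksum / t"
proof -
  show "0 \<le> H t"
    unfolding H_eq[OF assms] using assms k_nonneg denom_pos[of _ y t]
    by (intro sum_nonneg mult_nonneg_nonneg divide_nonneg_pos) auto
  have "(a \<alpha> y)\<^sup>2 * t / (m\<^sup>2 + (a \<alpha> y)\<^sup>2 * t\<^sup>2) \<le> 1 / t" for \<alpha>
    using denom_pos[of \<alpha> y t] assms(2) by (simp add: field_simps power2_eq_square)
  then have "H t \<le> (\<Sum>\<alpha>\<in>A. cmod (k \<alpha>) * (1 / t))"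
    unfolding H_eq[OF assms] using k_nonneg assms(2) complex_Re_le_cmod
    by (intro sum_mono mult_mono) auto
  then show "H t \<le> ksum / t"
    by (simp add: ksum_def sum_distrib_right sum_divide_distrib)
qed

text \<open>The 3 is one \<open>ksum\<close> for \<open>H\<close> and two for the differences in the
  coupling.\<close>

lemma damping_bound:
  assumes "y \<in> Y" "0 < t"
  shows "cmod (damping y t) \<le> 3 * ksum / t * sqrt (energy t)"
proof -
  let ?S = "sqrt (energy t)"
  have "cmod (of_real (H t) * \<Phi> y t) \<le> ksum / t * ?S"
    unfolding norm_mult using H_bounds[OF assms] cmod_\<Phi>_le[OF assms(1), of t]
    by (intro mult_mono) auto
  moreover have "cmod (\<Sum>\<alpha>\<in>A. k \<alpha> / of_real t * (\<Phi> y t - \<Phi> (s \<alpha> y) t)) \<le>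
      (\<Sum>\<alpha>\<in>A. cmod (k \<alpha>) / t * (2 * ?S))"
  proof (rule sum_norm_le)
    fix \<alpha> assume "\<alpha> \<in> A"
    then have "cmod (\<Phi> y t - \<Phi> (s \<alpha> y) t) \<le> 2 * ?S"
      using norm_triangle_ineq4[of "\<Phi> y t" "\<Phi> (s \<alpha> y) t"] cmod_\<Phi>_le[OF assms(1), of t]
        cmod_\<Phi>_le[OF s_closed[OF _ assms(1)], of \<alpha> t] by linarith
    then show "cmod (k \<alpha> / of_real t * (\<Phi> y t - \<Phi> (s \<alpha> y) t)) \<le> cmod (k \<alpha>) / t * (2 * ?S)"
      unfolding norm_mult norm_divide norm_of_real using assms(2)
      by (intro mult_mono) auto
  qed
  moreover have "(\<Sum>\<alpha>\<in>A. cmod (k \<alpha>) / t * (2 * ?S)) = 2 * ksum / t * ?S"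
    by (simp add: ksum_def sum_distrib_right sum_divide_distrib sum_distrib_left mult_ac)
  ultimately show ?thesis
    unfolding damping_def
    using norm_triangle_ineq4[of "of_real (H t) * \<Phi> y t"
        "\<Sum>\<alpha>\<in>A. k \<alpha> / of_real t * (\<Phi> y t - \<Phi> (s \<alpha> y) t)"]
    by (simp add: algebra_simps)
qed

section \<open>Growth of the energy\<close>

lemma energy_deriv:
  assumes "0 < t"
  shows "(energy has_real_derivative (\<Sum>y\<in>Y. 2 * Re (cnj (\<Phi> y t) * damping y t))) (at t)"
proof -
  have "((\<lambda>t. (cmod (\<Phi> y t))\<^sup>2) has_real_derivative 2 * Re (cnj (\<Phi> y t) * damping y t)) (at t)"
    if "y \<in> Y" for y
  proof -
    have "((\<lambda>t. Re (cnj (\<Phi> y t) * \<Phi> y t)) has_vector_derivative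
        Re (cnj (\<Phi> y t) * velocity y t + cnj (velocity y t) * \<Phi> y t)) (at t)"
      by (intro bounded_linear.has_vector_derivative[OF bounded_linear_Re]
          has_vector_derivative_mult has_vector_derivative_cnj \<Phi>_velocity that assms)
    \<comment> \<open>The two rotation terms cancel, so only the damping changes the energy.\<close>
    moreover have "Re (cnj (\<Phi> y t) * velocity y t + cnj (velocity y t) * \<Phi> y t)
        = 2 * Re (cnj (\<Phi> y t) * damping y t)"
      by (simp add: velocity_def algebra_simps)
    moreover have "Re (cnj z * z) = (cmod z)\<^sup>2" for z
      by (simp add: cmod_power2) (simp add: power2_eq_square)
    ultimately show ?thesis
      by (simp add: has_real_derivative_iff_has_vector_derivative)
  qed
  then show ?thesis
    unfolding energy_def[abs_def] by (intro DERIV_sum) auto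
qed

text \<open>Pairing \<open>y\<close> with \<open>s \<alpha> y\<close> leaves \<open>- Re (k \<alpha>) (1 / t - a g) \<bar>\<Phi> y - \<Phi> (s \<alpha> y)\<bar>\<^sup>2\<close>, which has
  a good sign, and the oscillating term on the right.\<close>

lemma energy_deriv_le:
  assumes "0 < t"
  shows "(\<Sum>y\<in>Y. 2 * Re (cnj (\<Phi> y t) * damping y t)) \<le>
    (\<Sum>\<alpha>\<in>A. \<Sum>y\<in>Y. 2 * Re (k \<alpha>) * (a \<alpha> y * g \<alpha> y t) * Re (cross \<alpha> y t))"
proof -
  \<comment> \<open>The share of \<open>\<alpha>\<close> in
    \<open>Re (cnj (\<Phi> y t) * damping y t)\<close>, after splitting \<open>H t\<close> over
    \<open>A\<close> by \<open>H_eq\<close> at this \<open>y\<close>.\<close>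
  define D where "D \<alpha> y = Re (k \<alpha>) * (a \<alpha> y * g \<alpha> y t) * (cmod (\<Phi> y t))\<^sup>2
      - Re (k \<alpha> / of_real t * (cnj (\<Phi> y t) * (\<Phi> y t - \<Phi> (s \<alpha> y) t)))" for \<alpha> y
  have "2 * Re (cnj (\<Phi> y t) * damping y t) = (\<Sum>\<alpha>\<in>A. 2 * D \<alpha> y)" if "y \<in> Y" for y
  proof -
    have "cnj (\<Phi> y t) * damping y t = of_real (H t * (cmod (\<Phi> y t))\<^sup>2)
        - (\<Sum>\<alpha>\<in>A. k \<alpha> / of_real t * (cnj (\<Phi> y t) * (\<Phi> y t - \<Phi> (s \<alpha> y) t)))"
      unfolding damping_def right_diff_distrib[of "cnj (\<Phi> y t)"] sum_distrib_left
      by (intro arg_cong2[where f=minus] sum.cong)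
        (simp_all add: complex_norm_square algebra_simps del: of_real_power)
    then have "Re (cnj (\<Phi> y t) * damping y t) = H t * (cmod (\<Phi> y t))\<^sup>2
        - (\<Sum>\<alpha>\<in>A. Re (k \<alpha> / of_real t * (cnj (\<Phi> y t) * (\<Phi> y t - \<Phi> (s \<alpha> y) t))))"
      by (simp only: minus_complex.sel Re_complex_of_real Re_sum)
    moreover have "H t = (\<Sum>\<alpha>\<in>A. Re (k \<alpha>) * (a \<alpha> y * g \<alpha> y t))"
      unfolding H_eq[OF that assms] g_def by (simp add: power2_eq_square mult_ac)
    ultimately show ?thesis
      unfolding D_def sum_distrib_left[symmetric] sum_subtractf by (simp only: sum_distrib_right)
  qed
  then have "(\<Sum>y\<in>Y. 2 * Re (cnj (\<Phi> y t) * damping y t)) = (\<Sum>\<alpha>\<in>A. \<Sum>y\<in>Y. 2 * D \<alpha> y)"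
    by (subst sum.swap) simp
  also have "\<dots> \<le> (\<Sum>\<alpha>\<in>A. \<Sum>y\<in>Y. 2 * Re (k \<alpha>) * (a \<alpha> y * g \<alpha> y t) * Re (cross \<alpha> y t))"
  proof (rule sum_mono)
    fix \<alpha> assume \<alpha>: "\<alpha> \<in> A"
    \<comment> \<open>Since \<open>s \<alpha>\<close> permutes \<open>Y\<close>, the doubled sum is
      a sum over pairs.\<close>
    have "(\<Sum>y\<in>Y. 2 * D \<alpha> y) = (\<Sum>y\<in>Y. D \<alpha> y) + (\<Sum>y\<in>Y. D \<alpha> (s \<alpha> y))"
      by (simp add: sum_swap[OF \<alpha>, of "D \<alpha>"] sum_distrib_left[symmetric])
    also have "\<dots> = (\<Sum>y\<in>Y. D \<alpha> y + D \<alpha> (s \<alpha> y))"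
      by (simp add: sum.distrib)
    also have "\<dots> \<le> (\<Sum>y\<in>Y. 2 * Re (k \<alpha>) * (a \<alpha> y * g \<alpha> y t) * Re (cross \<alpha> y t))"
    proof (rule sum_mono)
      fix y assume y: "y \<in> Y"
      let ?u = "\<Phi> y t" and ?v = "\<Phi> (s \<alpha> y) t" and ?h = "a \<alpha> y * g \<alpha> y t"
      have h': "a \<alpha> (s \<alpha> y) * g \<alpha> (s \<alpha> y) t = ?h"
        by (simp add: g_def a_s[OF \<alpha> y])
      have "?h \<le> 1 / t"
        using denom_pos[of \<alpha> y t] assms by (simp add: g_def field_simps power2_eq_square)
      then have "0 \<le> Re (k \<alpha>) * (1 / t - ?h) * (cmod (?u - ?v))\<^sup>2"
        using k_nonneg[OF \<alpha>] by simp
      \<comment> \<open>The coupling terms of a pair add up to \<open>k \<alpha> / t\<close> times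
        the real number \<open>\<bar>u - v\<bar>\<^sup>2\<close>, so \<open>Im (k \<alpha>)\<close>
        drops out. The weight terms use \<open>\<bar>u\<bar>\<^sup>2 + \<bar>v\<bar>\<^sup>2 =
        \<bar>u - v\<bar>\<^sup>2 + 2 Re (cnj u * v)\<close>.\<close>
      moreover have "D \<alpha> y + D \<alpha> (s \<alpha> y) =
          2 * Re (k \<alpha>) * ?h * Re (cross \<alpha> y t) - Re (k \<alpha>) * (1 / t - ?h) * (cmod (?u - ?v))\<^sup>2"
        unfolding D_def h' s_invol[OF \<alpha> y] cross_def cmod_power2
        using assms by (simp add: field_simps power2_eq_square)
      ultimately show "D \<alpha> y + D \<alpha> (s \<alpha> y) \<le> 2 * Re (k \<alpha>) * ?h * Re (cross \<alpha> y t)"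
        by linarith
    qed
    finally show "(\<Sum>y\<in>Y. 2 * D \<alpha> y) \<le>
      (\<Sum>y\<in>Y. 2 * Re (k \<alpha>) * (a \<alpha> y * g \<alpha> y t) * Re (cross \<alpha> y t))" .
  qed
  finally show ?thesis .
qed

section \<open>Cancelling the oscillating terms\<close>

lemma cross_deriv:
  assumes "\<alpha> \<in> A" "y \<in> Y" "0 < t"
  obtains r where "(cross \<alpha> y has_vector_derivative
      (- \<i> * of_real (a \<alpha> y * c \<alpha>) * cross \<alpha> y t + r)) (at t)"
    and "cmod r \<le> 6 * ksum / t * energy t"
proof
  let ?z = "s \<alpha> y"
  let ?r = "cnj (\<Phi> y t) * damping ?z t + cnj (damping y t) * \<Phi> ?z t"
  have z: "?z \<in> Y"
    using assms s_closed by simp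
  have "((\<lambda>t. cnj (\<Phi> y t) * \<Phi> ?z t) has_vector_derivative
      cnj (\<Phi> y t) * velocity ?z t + cnj (velocity y t) * \<Phi> ?z t) (at t)"
    by (intro has_vector_derivative_mult has_vector_derivative_cnj \<Phi>_velocity z assms)
  \<comment> \<open>Conjugation reverses the frequency \<open>\<mu> y\<close>, leaving the
    difference evaluated by \<open>\<mu>_s\<close>; the damping terms form the remainder.\<close>
  moreover have "cnj (\<Phi> y t) * velocity ?z t + cnj (velocity y t) * \<Phi> ?z t
      = - \<i> * of_real (\<mu> y - \<mu> ?z) * cross \<alpha> y t + ?r"
    by (simp add: velocity_def cross_def algebra_simps)
  ultimately show "(cross \<alpha> y has_vector_derivative
      (- \<i> * of_real (a \<alpha> y * c \<alpha>) * cross \<alpha> y t + ?r)) (at t)"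
    unfolding \<mu>_s[OF assms(1,2)] by (simp add: cross_def[abs_def])
  have bnd: "cmod (\<Phi> p t) * cmod (damping q t) \<le> 3 * ksum / t * energy t"
    if "p \<in> Y" "q \<in> Y" for p q
  proof -
    have "cmod (\<Phi> p t) * cmod (damping q t)
        \<le> sqrt (energy t) * (3 * ksum / t * sqrt (energy t))"
      using that assms(3) energy_nonneg[of t] by (intro mult_mono cmod_\<Phi>_le damping_bound) auto
    also have "\<dots> = 3 * ksum / t * (sqrt (energy t))\<^sup>2"
      by (simp add: power2_eq_square)
    finally show ?thesis
      using energy_nonneg[of t] by simp
  qed
  have "cmod ?r \<le> cmod (\<Phi> y t) * cmod (damping ?z t) + cmod (damping y t) * cmod (\<Phi> ?z t)"
    by (rule norm_triangle_le) (simp add: norm_mult)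
  then show "cmod ?r \<le> 6 * ksum / t * energy t"
    using bnd[OF assms(2) z] bnd[OF z assms(2)]
    by (simp only: mult.commute[of "cmod (damping y t)"])
qed

lemma g_deriv:
  obtains d where "(g \<alpha> y has_real_derivative d) (at t)" and "\<bar>d\<bar> \<le> \<rho> \<alpha> y t"
proof
  let ?a = "a \<alpha> y"
  let ?D = "m\<^sup>2 + ?a\<^sup>2 * t\<^sup>2"
  \<comment> \<open>Written, up to sign, as \<open>\<rho>\<close> times a quotient of modulus at
    most 1.\<close>
  let ?d = "?a / ?D * ((m\<^sup>2 - ?a\<^sup>2 * t\<^sup>2) / ?D)"
  have D: "0 < ?D" by (rule denom_pos)
  show "(g \<alpha> y has_real_derivative ?d) (at t)"
    unfolding g_def[abs_def] using D
    by (auto intro!: derivative_eq_intros simp: divide_simps) (simp add: algebra_simps power2_eq_square)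
  have "\<bar>(m\<^sup>2 - ?a\<^sup>2 * t\<^sup>2) / ?D\<bar> \<le> 1"
    using D by (simp add: abs_divide) (simp add: abs_le_iff)
  then have "\<bar>?a / ?D\<bar> * \<bar>(m\<^sup>2 - ?a\<^sup>2 * t\<^sup>2) / ?D\<bar> \<le> \<bar>?a / ?D\<bar>"
    by (intro mult_left_le) auto
  then show "\<bar>?d\<bar> \<le> \<rho> \<alpha> y t"
    using D unfolding \<rho>_def by (simp add: abs_mult)
qed

text \<open>In the product rule the rotation of \<open>cross\<close> yields the subtracted term,
  with \<open>c \<alpha>\<close> cancelling. The derivative of \<open>g\<close> is bounded by
  \<open>\<rho>\<close>, and the 1 / t in the remainder from \<open>cross_deriv\<close> turns
  \<open>g\<close> into \<open>\<rho>\<close>.\<close>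

lemma correction_term_deriv:
  assumes "\<alpha> \<in> A" "y \<in> Y" "0 < t"
  obtains d where "((\<lambda>t. 2 * Re (k \<alpha>) / c \<alpha> * (g \<alpha> y t * Im (cross \<alpha> y t))) has_real_derivative d) (at t)"
    and "d \<le> rate \<alpha> * \<rho> \<alpha> y t * energy t - 2 * Re (k \<alpha>) * (a \<alpha> y * g \<alpha> y t) * Re (cross \<alpha> y t)"
proof -
  obtain r where r: "(cross \<alpha> y has_vector_derivative
      (- \<i> * of_real (a \<alpha> y * c \<alpha>) * cross \<alpha> y t + r)) (at t)"
    and r_le: "cmod r \<le> 6 * ksum / t * energy t"
    using cross_deriv[OF assms] .
  obtain d where d: "(g \<alpha> y has_real_derivative d) (at t)" and d_le: "\<bar>d\<bar> \<le> \<rho> \<alpha> y t"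
    using g_deriv .
  let ?q = "2 * Re (k \<alpha>) / c \<alpha>" and ?X = "Im (cross \<alpha> y t)"
  let ?d = "?q * (d * ?X + (- (a \<alpha> y * c \<alpha>) * Re (cross \<alpha> y t) + Im r) * g \<alpha> y t)"
  have "((\<lambda>t. Im (cross \<alpha> y t)) has_real_derivative
      - (a \<alpha> y * c \<alpha>) * Re (cross \<alpha> y t) + Im r) (at t)"
    using bounded_linear.has_vector_derivative[OF bounded_linear_Im r]
    by (simp add: has_real_derivative_iff_has_vector_derivative)
  then have 1: "((\<lambda>t. q * (g \<alpha> y t * Im (cross \<alpha> y t))) has_real_derivative
      q * (d * ?X + (- (a \<alpha> y * c \<alpha>) * Re (cross \<alpha> y t) + Im r) * g \<alpha> y t)) (at t)" for q
    by (intro DERIV_cmult DERIV_mult d)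
  have X: "\<bar>?X\<bar> \<le> energy t"
    using abs_Im_le_cmod[of "cross \<alpha> y t"] cmod_cross_le[OF assms(1,2), of t] by linarith
  have "\<bar>d * ?X\<bar> \<le> \<rho> \<alpha> y t * energy t"
    unfolding abs_mult using d_le X by (intro mult_mono) auto
  moreover have "\<bar>Im r * g \<alpha> y t\<bar> \<le> (6 * ksum / t * energy t) * \<bar>g \<alpha> y t\<bar>"
    unfolding abs_mult using abs_Im_le_cmod[of r] r_le by (intro mult_right_mono) auto
  moreover have "(6 * ksum / t * energy t) * \<bar>g \<alpha> y t\<bar> = 6 * ksum * \<rho> \<alpha> y t * energy t"
    unfolding g_over_t[OF assms(3), symmetric] by simp
  ultimately have le: "\<bar>d * ?X + Im r * g \<alpha> y t\<bar> \<le> (1 + 6 * ksum) * \<rho> \<alpha> y t * energy t"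
    by (simp add: algebra_simps)
  have "?q * (d * ?X + Im r * g \<alpha> y t) \<le> \<bar>?q\<bar> * \<bar>d * ?X + Im r * g \<alpha> y t\<bar>"
    using abs_ge_self[of "?q * (d * ?X + Im r * g \<alpha> y t)"] by (simp only: abs_mult)
  also have "\<dots> \<le> \<bar>?q\<bar> * ((1 + 6 * ksum) * \<rho> \<alpha> y t * energy t)"
    using le by (intro mult_left_mono) auto
  also have "\<dots> = rate \<alpha> * \<rho> \<alpha> y t * energy t"
    using k_nonneg[OF assms(1)] by (simp add: rate_def abs_mult)
  finally have "?d \<le> rate \<alpha> * \<rho> \<alpha> y t * energy t - 2 * Re (k \<alpha>) * (a \<alpha> y * g \<alpha> y t) * Re (cross \<alpha> y t)"
    using c_nz[OF assms(1)] by (simp add: field_simps)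
  with 1 show ?thesis
    using that by blast
qed

text \<open>The terms bounding the energy derivative in \<open>energy_deriv_le\<close> cancel
  exactly against those produced by the correction.\<close>

lemma corrected_energy_deriv:
  assumes "0 < t"
  obtains d where "((\<lambda>t. energy t + correction t) has_real_derivative d) (at t)"
    and "d \<le> (\<Sum>\<alpha>\<in>A. \<Sum>y\<in>Y. rate \<alpha> * \<rho> \<alpha> y t) * energy t"
proof -
  let ?F = "\<lambda>\<alpha> y t. 2 * Re (k \<alpha>) / c \<alpha> * (g \<alpha> y t * Im (cross \<alpha> y t))"
  \<comment> \<open>\<open>deriv\<close> selects the derivatives as one function of
    \<open>\<alpha>\<close> and \<open>y\<close>, which can then be summed.\<close>
  define d where "d \<alpha> y = deriv (?F \<alpha> y) t" for \<alpha> y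
  have d: "(?F \<alpha> y has_real_derivative d \<alpha> y) (at t)"
    and d_le: "d \<alpha> y \<le> rate \<alpha> * \<rho> \<alpha> y t * energy t
        - 2 * Re (k \<alpha>) * (a \<alpha> y * g \<alpha> y t) * Re (cross \<alpha> y t)"
    if *: "\<alpha> \<in> A" "y \<in> Y" for \<alpha> y
  proof -
    obtain d' where "(?F \<alpha> y has_real_derivative d') (at t)"
      and "d' \<le> rate \<alpha> * \<rho> \<alpha> y t * energy t
        - 2 * Re (k \<alpha>) * (a \<alpha> y * g \<alpha> y t) * Re (cross \<alpha> y t)"
      using correction_term_deriv[OF * assms] .
    moreover from this(1) have "d \<alpha> y = d'"
      unfolding d_def by (rule DERIV_imp_deriv)
    ultimately show "(?F \<alpha> y has_real_derivative d \<alpha> y) (at t)"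
      and "d \<alpha> y \<le> rate \<alpha> * \<rho> \<alpha> y t * energy t
        - 2 * Re (k \<alpha>) * (a \<alpha> y * g \<alpha> y t) * Re (cross \<alpha> y t)"
      by simp_all
  qed
  let ?e = "\<Sum>y\<in>Y. 2 * Re (cnj (\<Phi> y t) * damping y t)"
  have "((\<lambda>t. energy t + correction t) has_real_derivative ?e + (\<Sum>\<alpha>\<in>A. \<Sum>y\<in>Y. d \<alpha> y)) (at t)"
    unfolding correction_def using d by (intro DERIV_add energy_deriv assms DERIV_sum)
  moreover have "(\<Sum>\<alpha>\<in>A. \<Sum>y\<in>Y. d \<alpha> y) \<le> (\<Sum>\<alpha>\<in>A. \<Sum>y\<in>Y. rate \<alpha> * \<rho> \<alpha> y t * energy t
        - 2 * Re (k \<alpha>) * (a \<alpha> y * g \<alpha> y t) * Re (cross \<alpha> y t))"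
    by (intro sum_mono d_le)
  moreover have "\<dots> = (\<Sum>\<alpha>\<in>A. \<Sum>y\<in>Y. rate \<alpha> * \<rho> \<alpha> y t) * energy t
      - (\<Sum>\<alpha>\<in>A. \<Sum>y\<in>Y. 2 * Re (k \<alpha>) * (a \<alpha> y * g \<alpha> y t) * Re (cross \<alpha> y t))"
    by (simp add: sum_subtractf sum_distrib_right)
  ultimately show ?thesis
    using that energy_deriv_le[OF assms] by fastforce
qed

text \<open>The purpose of \<open>m_large\<close>: together with \<open>abs_g_le\<close> it makes
  the corrected energy comparable to the energy.\<close>

lemma abs_correction_le: "\<bar>correction t\<bar> \<le> energy t / 2"
proof -
  have "\<bar>correction t\<bar> \<le> (\<Sum>\<alpha>\<in>A. \<Sum>y\<in>Y. \<bar>2 * Re (k \<alpha>) / c \<alpha> * (g \<alpha> y t * Im (cross \<alpha> y t))\<bar>)"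
    unfolding correction_def by (intro sum_abs[THEN order_trans] sum_mono sum_abs)
  also have "\<dots> \<le> (\<Sum>\<alpha>\<in>A. \<Sum>y\<in>Y. 2 * Re (k \<alpha>) / \<bar>c \<alpha>\<bar> * (1 / (2 * m) * energy t))"
  proof (intro sum_mono)
    fix \<alpha> y assume *: "\<alpha> \<in> A" "y \<in> Y"
    have "\<bar>g \<alpha> y t * Im (cross \<alpha> y t)\<bar> \<le> 1 / (2 * m) * energy t"
      unfolding abs_mult
      using abs_g_le abs_Im_le_cmod[of "cross \<alpha> y t"] cmod_cross_le[OF *, of t] m_ge_1
      by (intro mult_mono) auto
    moreover have "\<bar>2 * Re (k \<alpha>) / c \<alpha>\<bar> = 2 * Re (k \<alpha>) / \<bar>c \<alpha>\<bar>"
      using k_nonneg[OF *(1)] by (simp add: abs_mult)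
    ultimately show "\<bar>2 * Re (k \<alpha>) / c \<alpha> * (g \<alpha> y t * Im (cross \<alpha> y t))\<bar>
        \<le> 2 * Re (k \<alpha>) / \<bar>c \<alpha>\<bar> * (1 / (2 * m) * energy t)"
      unfolding abs_mult[of "2 * Re (k \<alpha>) / c \<alpha>"] using k_nonneg[OF *(1)]
      by (intro mult_mono) auto
  qed
  also have "\<dots> = (2 * real (card Y) * (\<Sum>\<alpha>\<in>A. Re (k \<alpha>) / \<bar>c \<alpha>\<bar>)) * (energy t / (2 * m))"
    by (simp add: sum_distrib_left sum_distrib_right mult_ac)
  also have "\<dots> \<le> m * (energy t / (2 * m))"
    using m_large m_ge_1 energy_nonneg[of t] by (intro mult_right_mono) auto
  also have "\<dots> = energy t / 2"
    using m_ge_1 by simp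
  finally show ?thesis .
qed

section \<open>Gronwall estimate, uniform in \<open>a\<close>\<close>

definition \<Theta> :: "real \<Rightarrow> real" where
  "\<Theta> t = (\<Sum>\<alpha>\<in>A. \<Sum>y\<in>Y. rate \<alpha> * (arctan (\<bar>a \<alpha> y\<bar> * t / m) / m))"

lemma rate_nonneg: "\<alpha> \<in> A \<Longrightarrow> 0 \<le> rate \<alpha>"
  unfolding rate_def ksum_def using k_nonneg
  by (intro mult_nonneg_nonneg divide_nonneg_nonneg add_nonneg_nonneg sum_nonneg) auto

text \<open>Supplies the integrating factor: the derivative is the coefficient in
  \<open>corrected_energy_deriv\<close>.\<close>

lemma \<Theta>_deriv: "(\<Theta> has_real_derivative (\<Sum>\<alpha>\<in>A. \<Sum>y\<in>Y. rate \<alpha> * \<rho> \<alpha> y t)) (at t)"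
proof -
  have "((\<lambda>t. arctan (\<bar>a \<alpha> y\<bar> * t / m) / m) has_real_derivative \<rho> \<alpha> y t) (at t)" for \<alpha> y
  proof -
    have "((\<lambda>t. arctan (\<bar>a \<alpha> y\<bar> * t / m) / m) has_real_derivative
        inverse (1 + (\<bar>a \<alpha> y\<bar> * t / m)\<^sup>2) * (\<bar>a \<alpha> y\<bar> / m) / m) (at t)"
      using m_ge_1 by (auto intro!: derivative_eq_intros)
    moreover have "inverse (1 + (\<bar>a \<alpha> y\<bar> * t / m)\<^sup>2) * (\<bar>a \<alpha> y\<bar> / m) / m = \<rho> \<alpha> y t"
    proof -
      have "1 + (\<bar>a \<alpha> y\<bar> * t / m)\<^sup>2 = (m\<^sup>2 + (a \<alpha> y)\<^sup>2 * t\<^sup>2) / m\<^sup>2"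
        using m_ge_1 by (simp add: power_divide power_mult_distrib add_divide_distrib)
      then show ?thesis
        using m_ge_1 by (simp add: \<rho>_def power2_eq_square)
    qed
    ultimately show ?thesis by simp
  qed
  then show ?thesis
    unfolding \<Theta>_def[abs_def] by (intro DERIV_sum DERIV_cmult)
qed

text \<open>The bound is free of \<open>a\<close>, because arctan stays below \<pi> / 2 < 2 and
  \<open>1 \<le> m\<close>.\<close>

lemma \<Theta>_le: "\<Theta> t \<le> 2 * real (card Y) * (\<Sum>\<alpha>\<in>A. rate \<alpha>)"
proof -
  have "arctan x / m \<le> 2" for x
  proof -
    have "arctan x \<le> 2 * m"
      using arctan_ubound[of x] pi_less_4 m_ge_1 by linarith
    then show ?thesis
      using m_ge_1 by (simp add: field_simps)
  qed
  then have "\<Theta> t \<le> (\<Sum>\<alpha>\<in>A. \<Sum>y\<in>Y. rate \<alpha> * 2)"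
    unfolding \<Theta>_def using rate_nonneg by (intro sum_mono mult_left_mono) auto
  then show ?thesis
    by (simp add: sum_distrib_left sum_distrib_right mult_ac)
qed

text \<open>The system is singular at 0, so derivatives are available only for positive times;
  continuity lets the monotonicity argument start at 0.\<close>

lemma continuous_corrected_energy: "continuous_on {0..} (\<lambda>t. energy t + correction t)"
proof -
  have "continuous_on {0..} (g \<alpha> y)" for \<alpha> y
    by (intro continuous_at_imp_continuous_on ballI) (meson g_deriv DERIV_isCont)
  moreover have "continuous_on {0..} (cross \<alpha> y)" if "\<alpha> \<in> A" "y \<in> Y" for \<alpha> y
    unfolding cross_def[abs_def] using that by (intro continuous_intros \<Phi>_cont s_closed)
  ultimately show ?thesis
    unfolding energy_def[abs_def] correction_def[abs_def]
    by (intro continuous_on_add continuous_on_sum continuous_on_mult continuous_on_const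
        continuous_on_power continuous_on_norm continuous_on_Im \<Phi>_cont)
qed

lemma energy_bound:
  assumes "0 \<le> T"
  shows "energy T \<le> 2 * energy 0 * exp (4 * real (card Y) * (\<Sum>\<alpha>\<in>A. rate \<alpha>))"
proof -
  let ?E = "\<lambda>t. energy t + correction t"
  \<comment> \<open>The exponent carries a 2 because the coefficient multiplies
    \<open>energy\<close>, which is at most twice the corrected energy.\<close>
  define F where "F t = ?E t * exp (- 2 * \<Theta> t)" for t
  have E: "energy t \<le> 2 * ?E t" for t
    using abs_correction_le[of t] by (simp add: abs_le_iff)
  have "F T \<le> F 0"
  proof (cases "T = 0")
    case False
    show ?thesis
    proof (rule DERIV_nonpos_imp_decreasing_open[of 0 T])
      show "continuous_on {0..T} F"
        unfolding F_def[abs_def]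
        by (intro continuous_intros continuous_on_subset[OF continuous_corrected_energy]
            continuous_at_imp_continuous_on ballI DERIV_isCont[OF \<Theta>_deriv]) auto
      fix t :: real assume t: "0 < t" "t < T"
      let ?\<rho> = "\<Sum>\<alpha>\<in>A. \<Sum>y\<in>Y. rate \<alpha> * \<rho> \<alpha> y t"
      obtain d where d: "(?E has_real_derivative d) (at t)" and d_le: "d \<le> ?\<rho> * energy t"
        using corrected_energy_deriv[OF t(1)] .
      have "(F has_real_derivative
          d * exp (- 2 * \<Theta> t) + exp (- 2 * \<Theta> t) * (- 2 * ?\<rho>) * ?E t) (at t)"
        unfolding F_def[abs_def] by (intro DERIV_mult d DERIV_fun_exp DERIV_cmult \<Theta>_deriv)
      moreover have "0 \<le> ?\<rho>"
        using rate_nonneg denom_pos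
        by (intro sum_nonneg mult_nonneg_nonneg) (auto simp: \<rho>_def less_imp_le)
      then have "?\<rho> * energy t \<le> 2 * ?\<rho> * ?E t"
        using mult_left_mono[OF E, of ?\<rho> t] by (simp only: mult.assoc mult.left_commute[of 2])
      then have "exp (- 2 * \<Theta> t) * (d - 2 * ?\<rho> * ?E t) \<le> 0"
        using d_le by (intro mult_nonneg_nonpos) auto
      then have "d * exp (- 2 * \<Theta> t) + exp (- 2 * \<Theta> t) * (- 2 * ?\<rho>) * ?E t \<le> 0"
        by (simp add: algebra_simps)
      ultimately show "\<exists>y. (F has_real_derivative y) (at t) \<and> y \<le> 0"
        by blast
    qed (use assms False in auto)
  qed simp
  \<comment> \<open>At time 0 both \<open>g\<close> and \<open>\<Theta>\<close> vanish.\<close>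
  moreover have "F 0 = energy 0"
    by (simp add: F_def \<Theta>_def correction_def g_def)
  ultimately have "?E T * exp (- 2 * \<Theta> T) * exp (2 * \<Theta> T) \<le> energy 0 * exp (2 * \<Theta> T)"
    unfolding F_def by (intro mult_right_mono) auto
  then have "?E T \<le> energy 0 * exp (2 * \<Theta> T)"
    by (simp add: mult.assoc flip: exp_add)
  also have "\<dots> \<le> energy 0 * exp (4 * real (card Y) * (\<Sum>\<alpha>\<in>A. rate \<alpha>))"
    using \<Theta>_le[of T] energy_nonneg[of 0] by (intro mult_left_mono) auto
  finally show ?thesis
    using E[of T] by simp
qed

end

section \<open>Reflection groups\<close>

lemma linear_refl_root: "linear (refl_root \<alpha>)"
  by (rule linearI) (simp_all add: refl_root_def inner_add_right algebra_simps)

lemma inner_refl_root: "\<beta> \<bullet> refl_root \<alpha> x = refl_root \<alpha> \<beta> \<bullet> x"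
  by (simp add: refl_root_def inner_diff_left inner_diff_right inner_commute)

lemma refl_root_involutive: "\<alpha> \<bullet> \<alpha> = 2 \<Longrightarrow> refl_root \<alpha> (refl_root \<alpha> x) = x"
  by (simp add: refl_root_def algebra_simps flip: scaleR_add_left)

lemma refl_root_self: "\<alpha> \<bullet> \<alpha> = 2 \<Longrightarrow> refl_root \<alpha> \<alpha> = - \<alpha>"
  by (simp add: refl_root_def scaleR_2)

lemma refl_root_in_refl_group: "\<alpha> \<in> R \<Longrightarrow> refl_root \<alpha> \<in> refl_group R"
  using refl_group_step[OF _ refl_group_id] by fastforce

lemma linear_refl_group: "w \<in> refl_group R \<Longrightarrow> linear w"
proof (induction rule: refl_group.induct)
  case (refl_group_step \<alpha> w)
  show ?case
    using linear_compose[OF refl_group_step.IH linear_refl_root] .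
qed (rule linear_id)

lemma refl_group_image:
  assumes "reduced_root_system R" and "w \<in> refl_group R"
  shows "w ` R \<subseteq> R"
  using assms(2)
proof (induction rule: refl_group.induct)
  case (refl_group_step \<alpha> w)
  have "(refl_root \<alpha> \<circ> w) ` R \<subseteq> refl_root \<alpha> ` R"
    using refl_group_step.IH by (auto simp: image_comp[symmetric])
  also have "\<dots> = R"
    using assms(1) refl_group_step.hyps(1) by (simp add: reduced_root_system_def)
  finally show ?case .
qed simp

text \<open>A group element is linear and maps \<open>R\<close> into itself, and \<open>R\<close>
  spans, so it is determined by a self-map of a finite set.\<close>

lemma finite_refl_group:
  fixes R :: "'a::euclidean_space set"
  assumes "reduced_root_system R"
  shows "finite (refl_group R)"
proof (rule inj_on_finite)
  show "inj_on (\<lambda>w. restrict w R) (refl_group R)"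
  proof (rule inj_onI, rule ext)
    fix v w x assume v: "v \<in> refl_group R" and w: "w \<in> refl_group R"
      and eq: "restrict v R = restrict w R"
    have "v y = w y" if "y \<in> R" for y
      using fun_cong[OF eq, of y] that by simp
    moreover have "x \<in> span R"
      using assms by (simp add: reduced_root_system_def)
    ultimately show "v x = w x"
      using linear_eq_on_span[OF linear_refl_group[OF v] linear_refl_group[OF w]] by blast
  qed
  show "(\<lambda>w. restrict w R) ` refl_group R \<subseteq> R \<rightarrow>\<^sub>E R"
    using refl_group_image[OF assms] by (auto simp: image_subset_iff)
  show "finite (R \<rightarrow>\<^sub>E R)"
    using assms by (simp add: reduced_root_system_def finite_PiE)
qed

text \<open>A reflection permutes \<open>R\<close> but not \<open>Rp\<close>. For even
  \<open>u\<close> the summand does not distinguish \<alpha> from -\<alpha>, so the sum over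
  \<open>Rp\<close> is half the sum over \<open>R\<close>, which can be reindexed.\<close>

lemma sum_positive_roots_refl_root:
  fixes u :: "real \<Rightarrow> real"
  assumes R: "reduced_root_system R" and Rp: "positive_roots R Rp"
    and k: "invariant_multiplicity R k" and \<beta>: "\<beta> \<in> R" and even: "\<And>r. u (- r) = u r"
  shows "(\<Sum>\<alpha>\<in>Rp. Re (k \<alpha>) * u (\<alpha> \<bullet> refl_root \<beta> x)) = (\<Sum>\<alpha>\<in>Rp. Re (k \<alpha>) * u (\<alpha> \<bullet> x))"
proof -
  have fin: "finite R" and norm2: "\<And>\<alpha>. \<alpha> \<in> R \<Longrightarrow> \<alpha> \<bullet> \<alpha> = 2"
    and stable: "\<And>\<alpha>. \<alpha> \<in> R \<Longrightarrow> refl_root \<alpha> ` R = R"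
    using R by (auto simp: reduced_root_system_def)
  have k_refl: "k (refl_root \<gamma> \<alpha>) = k \<alpha>" if "\<gamma> \<in> R" "\<alpha> \<in> R" for \<gamma> \<alpha>
    using k that refl_root_in_refl_group by (auto simp: invariant_multiplicity_def)
  \<comment> \<open>\<open>- \<alpha>\<close> is the reflection of \<alpha> in its own
    hyperplane.\<close>
  have neg: "- \<alpha> \<in> R" "k (- \<alpha>) = k \<alpha>" if "\<alpha> \<in> R" for \<alpha>
    using imageI[OF that, of "refl_root \<alpha>"] k_refl[OF that that]
    by (simp_all add: stable[OF that] refl_root_self[OF norm2[OF that]])
  obtain v where v: "\<And>\<alpha>. \<alpha> \<in> R \<Longrightarrow> \<alpha> \<bullet> v \<noteq> 0" and Rp_eq: "Rp = {\<alpha> \<in> R. \<alpha> \<bullet> v > 0}"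
    using Rp by (auto simp: positive_roots_def)
  have half: "(\<Sum>\<alpha>\<in>R. Re (k \<alpha>) * u (\<alpha> \<bullet> y)) = 2 * (\<Sum>\<alpha>\<in>Rp. Re (k \<alpha>) * u (\<alpha> \<bullet> y))" for y
  proof -
    let ?f = "\<lambda>\<alpha>. Re (k \<alpha>) * u (\<alpha> \<bullet> y)"
    have "R = Rp \<union> {\<alpha> \<in> R. \<alpha> \<bullet> v < 0}"
      unfolding Rp_eq using v by fastforce
    then have "sum ?f R = sum ?f (Rp \<union> {\<alpha> \<in> R. \<alpha> \<bullet> v < 0})"
      by simp
    also have "\<dots> = sum ?f Rp + sum ?f {\<alpha> \<in> R. \<alpha> \<bullet> v < 0}"
      unfolding Rp_eq using fin by (intro sum.union_disjoint) auto
    also have "sum ?f {\<alpha> \<in> R. \<alpha> \<bullet> v < 0} = sum ?f Rp"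
      unfolding Rp_eq
      by (rule sum.reindex_bij_witness[where i=uminus and j=uminus]) (auto simp: neg even)
    finally show ?thesis by simp
  qed
  have "(\<Sum>\<alpha>\<in>R. Re (k \<alpha>) * u (\<alpha> \<bullet> refl_root \<beta> x)) = (\<Sum>\<alpha>\<in>R. Re (k \<alpha>) * u (\<alpha> \<bullet> x))"
    by (rule sum.reindex_bij_witness[where i="refl_root \<beta>" and j="refl_root \<beta>"])
      (use stable[OF \<beta>] k_refl[OF \<beta>] refl_root_involutive[OF norm2[OF \<beta>]]
        in \<open>auto simp: inner_refl_root\<close>)
  then show ?thesis
    unfolding half by simp
qed

text \<open>Lets one weight serve all rays of an orbit.\<close>

lemma sum_positive_roots_refl_group:
  fixes u :: "real \<Rightarrow> real"
  assumes "reduced_root_system R" "positive_roots R Rp" "invariant_multiplicity R k"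
    and "\<And>r. u (- r) = u r" and "w \<in> refl_group R"
  shows "(\<Sum>\<alpha>\<in>Rp. Re (k \<alpha>) * u (\<alpha> \<bullet> w x)) = (\<Sum>\<alpha>\<in>Rp. Re (k \<alpha>) * u (\<alpha> \<bullet> x))"
  using assms(5)
proof (induction rule: refl_group.induct)
  case (refl_group_step \<beta> w)
  then show ?case
    using sum_positive_roots_refl_root[where u=u and x="w x", OF assms(1-3) _ assms(4)] by simp
qed simp

section \<open>The Dunkl kernel along rays\<close>

text \<open>Joint differentiability is restricted to the slice with fixed \<open>l\<close>, so that
  \<open>dir_deriv\<close> is a genuine derivative.\<close>

lemma dunkl_kernel_has_derivative:
  assumes "dunkl_kernel Rp k E"
  shows "(E l has_derivative frechet_derivative (E l) (at z)) (at z)"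
proof -
  obtain D where D: "((\<lambda>p. E (fst p) (snd p)) has_derivative D) (at (l, z))"
    using assms unfolding dunkl_kernel_def holomorphic_cplxn2_def by blast
  have "((\<lambda>z. (l, z)) has_derivative (\<lambda>h. (0, h))) (at z)"
    by (auto intro!: derivative_eq_intros)
  from has_derivative_compose[OF this D] have "E l differentiable at z"
    unfolding differentiable_def by auto
  then show ?thesis
    by (simp add: frechet_derivative_works)
qed

lemma dunkl_kernel_ray_deriv_dir:
  assumes "dunkl_kernel Rp k E"
  shows "((\<lambda>t. E l (cemb (t *\<^sub>R y))) has_vector_derivative dir_deriv y (E l) (cemb (t *\<^sub>R y))) (at t)"
proof -
  have "((\<lambda>t. cemb (t *\<^sub>R y)) has_derivative (\<lambda>h. cemb (h *\<^sub>R y))) (at t)"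
    unfolding cemb_def by (auto intro!: derivative_eq_intros)
  from has_derivative_compose[OF this dunkl_kernel_has_derivative[OF assms]]
  have "((\<lambda>t. E l (cemb (t *\<^sub>R y))) has_derivative
      (\<lambda>h. frechet_derivative (E l) (at (cemb (t *\<^sub>R y))) (cemb (h *\<^sub>R y)))) (at t)"
    by simp
  moreover have "frechet_derivative (E l) (at z) (cemb (h *\<^sub>R y)) = h *\<^sub>R dir_deriv y (E l) z" for h z
  proof -
    have "cemb (h *\<^sub>R y) = h *\<^sub>R cemb y"
      by (simp add: cemb_def)
    then show ?thesis
      using linear_cmul[OF has_derivative_linear[OF dunkl_kernel_has_derivative[OF assms]]]
      by (simp add: dir_deriv_def)
  qed
  ultimately show ?thesis
    by (simp add: has_vector_derivative_def)
qed

lemma cbil_cemb: "cbil (cemb x) (cemb y) = of_real (x \<bullet> y)"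
  by (simp add: cbil_def cemb_def complex_of_real_def)

lemma crefl_root_cemb: "crefl_root \<alpha> (cemb x) = cemb (refl_root \<alpha> x)"
  unfolding crefl_root_def refl_root_def cbil_cemb by (simp add: cscale_def cemb_def)

text \<open>At the point \<open>t y\<close> in direction \<open>y\<close> the quotient \<open>\<langle>\<alpha>, y\<rangle> / \<langle>\<alpha>, t y\<rangle>\<close> is \<open>1 / t\<close>; if
  \<open>\<langle>\<alpha>, y\<rangle> = 0\<close>, the corresponding difference vanishes anyway.\<close>

lemma dunkl_kernel_ray_deriv:
  assumes "dunkl_kernel Rp k E" and "t \<noteq> 0"
  shows "((\<lambda>t. E l (cemb (t *\<^sub>R y))) has_vector_derivative
    (cbil (cemb y) l * E l (cemb (t *\<^sub>R y))
      - (\<Sum>\<alpha>\<in>Rp. k \<alpha> / of_real t * (E l (cemb (t *\<^sub>R y)) - E l (cemb (t *\<^sub>R refl_root \<alpha> y)))))) (at t)"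
proof -
  let ?f = "E l" and ?z = "cemb (t *\<^sub>R y)"
  have "k \<alpha> * of_real (\<alpha> \<bullet> y) * dunkl_quotient \<alpha> ?f ?z
      = k \<alpha> / of_real t * (?f ?z - ?f (cemb (t *\<^sub>R refl_root \<alpha> y)))" for \<alpha>
  proof (cases "\<alpha> \<bullet> y = 0")
    case True
    then show ?thesis by (simp add: refl_root_def)
  next
    case False
    then have "cbil (cemb \<alpha>) ?z \<noteq> 0"
      using assms(2) by (simp add: cbil_cemb)
    moreover have "crefl_root \<alpha> ?z = cemb (t *\<^sub>R refl_root \<alpha> y)"
      by (simp add: crefl_root_cemb linear_cmul[OF linear_refl_root])
    ultimately show ?thesis
      using False assms(2) by (simp add: dunkl_quotient_def cbil_cemb)
  qed
  then have "dunkl_op Rp k y ?f ?z = dir_deriv y ?f ?z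
      + (\<Sum>\<alpha>\<in>Rp. k \<alpha> / of_real t * (?f ?z - ?f (cemb (t *\<^sub>R refl_root \<alpha> y))))"
    by (simp add: dunkl_op_def)
  moreover have "dunkl_op Rp k y ?f ?z = cbil (cemb y) l * ?f ?z"
    using assms(1) unfolding dunkl_kernel_def by blast
  ultimately show ?thesis
    using dunkl_kernel_ray_deriv_dir[OF assms(1), of l y t] by (simp add: algebra_simps)
qed

text \<open>The bases are positive reals, so only the real part of an exponent affects the
  modulus.\<close>

lemma cmod_Omega_inv_sqrt:
  assumes "finite Rp"
  shows "cmod (Omega_inv_sqrt Rp k x) = exp (- (\<Sum>\<alpha>\<in>Rp. Re (k \<alpha>) * ln (1 + \<bar>\<alpha> \<bullet> x\<bar>)))"
proof -
  have "cmod (complex_of_real (1 + \<bar>\<alpha> \<bullet> x\<bar>) powr (- k \<alpha>)) = exp (- (Re (k \<alpha>) * ln (1 + \<bar>\<alpha> \<bullet> x\<bar>)))" for \<alpha>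
    by (subst norm_powr_real_powr) (auto simp: powr_def)
  then show ?thesis
    using assms by (simp add: Omega_inv_sqrt_def prod_norm[symmetric] exp_sum sum_negf[symmetric])
qed

section \<open>The estimate, uniform over all orbits\<close>

theorem theorem2p2:
  fixes R Rp :: "'a::euclidean_space set"
    and k :: "'a \<Rightarrow> complex"
    and Exp_k :: "'a cplxn \<Rightarrow> 'a cplxn \<Rightarrow> complex"
    and lam :: 'a
  assumes "reduced_root_system R"
    and "positive_roots R Rp"
    and "invariant_multiplicity R k"
    and "\<forall>\<alpha>\<in>R. Re (k \<alpha>) \<ge> 0"
    and "dunkl_kernel Rp k Exp_k"
    and "lam \<in> regular_points R"
  shows "\<exists>C\<ge>0. \<forall>x::'a.
    cmod (Exp_k (cscale \<i> (cemb lam)) (cemb x)) \<le> C * cmod (Omega_inv_sqrt Rp k x)"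
proof -
  define f where "f x = Exp_k (cscale \<i> (cemb lam)) (cemb x)" for x
  \<comment> \<open>All constants are independent of the point \<open>x\<close>. \<open>n\<close>
    bounds the size of every orbit, \<open>m\<close> is chosen to satisfy \<open>m_large\<close>,
    \<open>B\<close> is the weight at time 0, \<open>Q\<close> is the sum of the rates, and
    \<open>K\<close> bounds the energy at time 1.\<close>
  define n where "n = real (card (refl_group R))"
  define S where "S = (\<Sum>\<alpha>\<in>Rp. Re (k \<alpha>) / \<bar>\<alpha> \<bullet> lam\<bar>)"
  define m where "m = 1 + 2 * n * S"
  define B where "B = exp ((\<Sum>\<alpha>\<in>Rp. Re (k \<alpha>) * ln (m\<^sup>2)) / 2)"
  define Q where "Q = (\<Sum>\<alpha>\<in>Rp. 2 * Re (k \<alpha>) / \<bar>\<alpha> \<bullet> lam\<bar> * (1 + 6 * (\<Sum>\<alpha>\<in>Rp. cmod (k \<alpha>))))"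
  define K where "K = 2 * (n * B\<^sup>2) * exp (4 * n * Q)"
  define C where "C = sqrt K * exp (ln 2 * (\<Sum>\<alpha>\<in>Rp. Re (k \<alpha>)) / 2)"
  have sub: "Rp \<subseteq> R"
    using assms(2) by (auto simp: positive_roots_def)
  have fin: "finite Rp"
    using assms(1) sub finite_subset by (auto simp: reduced_root_system_def)
  have norm2: "\<alpha> \<bullet> \<alpha> = 2" if "\<alpha> \<in> Rp" for \<alpha>
    using assms(1) sub that by (auto simp: reduced_root_system_def)
  have k0: "0 \<le> Re (k \<alpha>)" if "\<alpha> \<in> Rp" for \<alpha>
    using assms(4) sub that by auto
  have S0: "0 \<le> S" and Q0: "0 \<le> Q"
    unfolding S_def Q_def using k0
    by (auto intro!: sum_nonneg mult_nonneg_nonneg divide_nonneg_nonneg add_nonneg_nonneg)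
  have m1: "1 \<le> m"
    using S0 by (simp add: m_def n_def)
  have f_cont: "continuous_on U (\<lambda>t. f (t *\<^sub>R y))" for U y
    unfolding f_def
    using dunkl_kernel_ray_deriv_dir[OF assms(5)] has_vector_derivative_continuous
    by (intro continuous_at_imp_continuous_on ballI) blast
  have f_0: "f 0 = 1"
    using assms(5) unfolding f_def dunkl_kernel_def cemb_def zero_prod_def[symmetric] by blast
  have bound: "cmod (f x) \<le> C * cmod (Omega_inv_sqrt Rp k x)" for x
  proof -
    define Y where "Y = (\<lambda>w. w x) ` refl_group R"
    define D where "D \<alpha> t = m\<^sup>2 + (\<alpha> \<bullet> x)\<^sup>2 * t\<^sup>2" for \<alpha> t
    \<comment> \<open>\<open>exp (L t)\<close> is the weight and \<open>H\<close> its logarithmic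
      derivative. Both are built from \<open>x\<close> alone; invariance transfers them to the other
      points of the orbit.\<close>
    define L where "L t = (\<Sum>\<alpha>\<in>Rp. Re (k \<alpha>) * ln (D \<alpha> t)) / 2" for t
    define H where "H t = (\<Sum>\<alpha>\<in>Rp. Re (k \<alpha>) * ((\<alpha> \<bullet> x)\<^sup>2 * t / D \<alpha> t))" for t
    define \<Phi> where "\<Phi> y t = of_real (exp (L t)) * f (t *\<^sub>R y)" for y t
    have D_pos: "0 < D \<alpha> t" for \<alpha> t
      using m1 by (simp add: D_def add_pos_nonneg)
    have L_deriv: "(L has_real_derivative H t) (at t)" for t
    proof -
      have "((\<lambda>t. Re (k \<alpha>) * ln (D \<alpha> t)) has_real_derivative
          2 * (Re (k \<alpha>) * ((\<alpha> \<bullet> x)\<^sup>2 * t / D \<alpha> t))) (at t)" for \<alpha>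
        using D_pos[of \<alpha> t] unfolding D_def
        by (auto intro!: derivative_eq_intros simp: field_simps)
      then have "(L has_real_derivative
          (\<Sum>\<alpha>\<in>Rp. 2 * (Re (k \<alpha>) * ((\<alpha> \<bullet> x)\<^sup>2 * t / D \<alpha> t))) / 2) (at t)"
        unfolding L_def[abs_def] by (intro DERIV_cdivide DERIV_sum)
      then show ?thesis
        unfolding H_def sum_distrib_left[symmetric] by simp
    qed
    have exp_deriv: "((\<lambda>t. complex_of_real (exp (L t))) has_vector_derivative
        of_real (H t * exp (L t))) (at t)" for t
      using DERIV_fun_exp[OF L_deriv[of t]]
      by (intro has_vector_derivative_of_real)
        (simp add: has_real_derivative_iff_has_vector_derivative mult.commute)
    have fin_Y: "finite Y" and card_Y: "real (card Y) \<le> n"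
      unfolding Y_def n_def using finite_refl_group[OF assms(1)] by (auto intro: card_image_le)
    have x_in: "x \<in> Y"
      unfolding Y_def by (rule image_eqI[OF _ refl_group_id]) simp
    interpret osc: damped_oscillators Y Rp refl_root "\<lambda>\<alpha> y. \<alpha> \<bullet> y" "\<lambda>\<alpha>. \<alpha> \<bullet> lam"
      "\<lambda>y. y \<bullet> lam" k m H \<Phi>
    proof
      fix \<alpha> y assume \<alpha>: "\<alpha> \<in> Rp" and y: "y \<in> Y"
      obtain w where w: "w \<in> refl_group R" "y = w x"
        using y by (auto simp: Y_def)
      have "refl_root \<alpha> \<circ> w \<in> refl_group R"
        using refl_group_step[OF _ w(1)] \<alpha> sub by blast
      then show "refl_root \<alpha> y \<in> Y"
        unfolding Y_def by (rule rev_image_eqI) (simp add: w(2))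
      show "refl_root \<alpha> (refl_root \<alpha> y) = y"
        by (rule refl_root_involutive[OF norm2[OF \<alpha>]])
      show "\<alpha> \<bullet> refl_root \<alpha> y = - (\<alpha> \<bullet> y)"
        by (simp add: inner_refl_root refl_root_self norm2[OF \<alpha>])
      show "y \<bullet> lam - refl_root \<alpha> y \<bullet> lam = \<alpha> \<bullet> y * (\<alpha> \<bullet> lam)"
        by (simp add: refl_root_def inner_diff_left)
    next
      fix \<alpha> assume "\<alpha> \<in> Rp"
      then show "\<alpha> \<bullet> lam \<noteq> 0"
        using assms(6) sub by (auto simp: regular_points_def)
    next
      have "2 * real (card Y) * S \<le> 2 * n * S"
        using card_Y S0 by (intro mult_right_mono) auto
      then show "2 * real (card Y) * (\<Sum>\<alpha>\<in>Rp. Re (k \<alpha>) / \<bar>\<alpha> \<bullet> lam\<bar>) \<le> m"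
        by (simp add: m_def S_def)
    next
      fix y t assume y: "y \<in> Y" and t: "(0::real) < t"
      obtain w where w: "w \<in> refl_group R" "y = w x"
        using y by (auto simp: Y_def)
      show "H t = (\<Sum>\<alpha>\<in>Rp. Re (k \<alpha>) * ((\<alpha> \<bullet> y)\<^sup>2 * t / (m\<^sup>2 + (\<alpha> \<bullet> y)\<^sup>2 * t\<^sup>2)))"
        unfolding H_def D_def w(2)
        by (rule sum_positive_roots_refl_group[OF assms(1-3) _ w(1), symmetric,
              where u="\<lambda>r. r\<^sup>2 * t / (m\<^sup>2 + r\<^sup>2 * t\<^sup>2)"]) simp
      \<comment> \<open>The factor \<open>\<i>\<close> in the spectral parameter makes the
        eigenvalue a pure rotation.\<close>
      have l: "cbil (cemb y) (cscale \<i> (cemb lam)) = \<i> * of_real (y \<bullet> lam)"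
        by (simp add: cbil_def cemb_def cscale_def complex_eq_iff)
      have "(\<Phi> y has_vector_derivative of_real (exp (L t)) *
          (\<i> * of_real (y \<bullet> lam) * f (t *\<^sub>R y)
            - (\<Sum>\<alpha>\<in>Rp. k \<alpha> / of_real t * (f (t *\<^sub>R y) - f (t *\<^sub>R refl_root \<alpha> y))))
          + of_real (H t * exp (L t)) * f (t *\<^sub>R y)) (at t)"
        unfolding \<Phi>_def[abs_def] f_def
        using dunkl_kernel_ray_deriv[OF assms(5), of t "cscale \<i> (cemb lam)" y] t
        by (intro has_vector_derivative_mult exp_deriv) (simp add: l)
      then show "(\<Phi> y has_vector_derivative
          (of_real (H t) + \<i> * of_real (y \<bullet> lam)) * \<Phi> y t
          - (\<Sum>\<alpha>\<in>Rp. k \<alpha> / of_real t * (\<Phi> y t - \<Phi> (refl_root \<alpha> y) t))) (at t)"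
        by (simp add: \<Phi>_def algebra_simps sum_distrib_left)
    next
      fix y assume "y \<in> Y"
      show "continuous_on {0..} (\<Phi> y)"
        unfolding \<Phi>_def[abs_def]
        by (intro continuous_intros f_cont continuous_at_imp_continuous_on ballI DERIV_isCont[OF L_deriv])
    qed (use fin_Y fin k0 m1 in auto)
    \<comment> \<open>As \<open>f 0 = 1\<close>, every ray starts at the value
      \<open>B\<close>.\<close>
    have "osc.energy 0 = real (card Y) * B\<^sup>2"
      by (simp add: osc.energy_def \<Phi>_def f_0 L_def D_def B_def norm_mult)
    \<comment> \<open>The ray through \<open>x\<close> reaches \<open>x\<close> at time 1.\<close>
    then have "osc.energy 1 \<le> 2 * (real (card Y) * B\<^sup>2) * exp (4 * real (card Y) * Q)"
      using osc.energy_bound[of 1] by (simp add: osc.rate_def osc.ksum_def Q_def)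
    also have "\<dots> \<le> K"
      unfolding K_def using card_Y Q0 by (intro mult_mono) (auto simp: mult_right_mono)
    finally have "cmod (\<Phi> x 1) \<le> sqrt K"
      using osc.cmod_\<Phi>_le[OF x_in, of 1] by (meson order_trans real_sqrt_le_mono)
    then have "exp (L 1) * cmod (f x) \<le> sqrt K"
      by (simp add: \<Phi>_def norm_mult)
    then have "cmod (f x) \<le> sqrt K * exp (- L 1)"
      by (simp add: exp_minus field_simps)
    moreover have "(\<Sum>\<alpha>\<in>Rp. Re (k \<alpha>) * ln (1 + \<bar>\<alpha> \<bullet> x\<bar>)) \<le> ln 2 * (\<Sum>\<alpha>\<in>Rp. Re (k \<alpha>)) / 2 + L 1"
    proof -
      have "ln (1 + \<bar>\<alpha> \<bullet> x\<bar>) \<le> (ln 2 + ln (D \<alpha> 1)) / 2" for \<alpha>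
      proof -
        \<comment> \<open>Replacing \<open>1 + \<bar>\<alpha> \<bullet> x\<bar>\<close> by the
          square root of \<open>D \<alpha> 1\<close> costs a factor \<open>sqrt 2\<close> per root;
          raised to the power \<open>Re (k \<alpha>)\<close>, these factors give the exponential in
          \<open>C\<close>.\<close>
        have "(1 + \<bar>\<alpha> \<bullet> x\<bar>)\<^sup>2 \<le> 2 * (1 + (\<alpha> \<bullet> x)\<^sup>2)"
          using sum_squares_bound[of 1 "\<bar>\<alpha> \<bullet> x\<bar>"] by (simp add: power2_eq_square algebra_simps)
        also have "\<dots> \<le> 2 * D \<alpha> 1"
          using m1 by (simp add: D_def)
        finally have "ln ((1 + \<bar>\<alpha> \<bullet> x\<bar>)\<^sup>2) \<le> ln (2 * D \<alpha> 1)"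
          using D_pos[of \<alpha> 1] by (subst ln_le_cancel_iff) auto
        then show ?thesis
          using D_pos[of \<alpha> 1] by (simp add: ln_realpow ln_mult)
      qed
      then have "(\<Sum>\<alpha>\<in>Rp. Re (k \<alpha>) * ln (1 + \<bar>\<alpha> \<bullet> x\<bar>)) \<le> (\<Sum>\<alpha>\<in>Rp. Re (k \<alpha>) * ((ln 2 + ln (D \<alpha> 1)) / 2))"
        using k0 by (intro sum_mono mult_left_mono)
      then show ?thesis
        by (simp add: L_def sum.distrib sum_distrib_left sum_divide_distrib algebra_simps add_divide_distrib)
    qed
    then have "exp (- L 1) \<le> exp (ln 2 * (\<Sum>\<alpha>\<in>Rp. Re (k \<alpha>)) / 2) * cmod (Omega_inv_sqrt Rp k x)"
      unfolding cmod_Omega_inv_sqrt[OF fin] exp_add[symmetric] by simp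
    then have "sqrt K * exp (- L 1) \<le> sqrt K * (exp (ln 2 * (\<Sum>\<alpha>\<in>Rp. Re (k \<alpha>)) / 2) * cmod (Omega_inv_sqrt Rp k x))"
      by (intro mult_left_mono) (auto simp: K_def n_def)
    ultimately show ?thesis
      by (simp add: C_def mult.assoc)
  qed
  have "0 \<le> C"
    by (simp add: C_def K_def n_def)
  with bound show ?thesis
    unfolding f_def by blast
qed

end
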